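(* Let $d>2$ and let $\phi_1,\phi_2\in\mathbb{Z}[y]$ be linearly independent polynomials with $\deg\phi_1=\deg\phi_2=d$ and $\phi_1(0)=\phi_2(0)=0$. Let $\widetilde F=(f_0,f_1,f_2):W\to\mathbb{A}^3$ be the associated augmented map, as defined in the context. Then every geometric fibre of $\widetilde F$ has dimension at most one; that is, for every $(c,u,v)\in\mathbb{A}^3(\mathbb{C})$ the fibre $\widetilde F^{-1}(c,u,v)\subset W_{\mathbb{C}}$ has dimension at most one.
   Context: Write $\phi_1(y)=ay^d+\cdots$, $\phi_2(y)=by^d+\cdots$ with $a,b\ne0$, and put $\alpha=b/a$, $D=\phi_2-\alpha\phi_1$. Let $$W=\{(y_1,y_2,y_3,y_4)\in\mathbb{A}^4:\ \phi_1(y_1)-\phi_1(y_2)=\phi_1(y_3)-\phi_1(y_4)\},$$ and, on $W$, $$f_0=D(y_4)-D(y_2),\qquad f_1=\phi_2(y_1)-\phi_2(y_2),\qquad f_2=\phi_2(y_4)-\phi_2(y_3).$$ *)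

theory Defs
  imports "HOL-Analysis.Analysis" "HOL-Computational_Algebra.Polynomial"
begin

section \<open>The Zariski topology on affine space\<close>

text \<open>Polynomial functions in the coordinates. Over an infinite field these are the same thing
  as multivariate polynomials.\<close>

inductive polyfun :: "('k::field ^ 'n \<Rightarrow> 'k) \<Rightarrow> bool" where
  polyfun_const: "polyfun (\<lambda>x. c)"
| polyfun_coord: "polyfun (\<lambda>x. x $ i)"
| polyfun_add: "polyfun f \<Longrightarrow> polyfun g \<Longrightarrow> polyfun (\<lambda>x. f x + g x)"
| polyfun_mult: "polyfun f \<Longrightarrow> polyfun g \<Longrightarrow> polyfun (\<lambda>x. f x * g x)"

definition zero_locus :: "('k::field ^ 'n \<Rightarrow> 'k) set \<Rightarrow> ('k ^ 'n) set" where
  "zero_locus S = {x. \<forall>f\<in>S. f x = 0}"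

definition algebraic_set :: "('k::field ^ 'n) set \<Rightarrow> bool" where
  "algebraic_set Z \<longleftrightarrow> (\<exists>S. S \<subseteq> Collect polyfun \<and> Z = zero_locus S)"

definition zariski :: "('k::field ^ 'n) topology" where
  "zariski = topology (\<lambda>U. algebraic_set (- U))"

lemma algebraic_set_UNIV: "algebraic_set UNIV"
  unfolding algebraic_set_def zero_locus_def by (rule exI[of _ "{}"]) auto

lemma algebraic_set_empty: "algebraic_set {}"
  unfolding algebraic_set_def zero_locus_def
  by (rule exI[of _ "{\<lambda>x. 1}"]) (auto intro: polyfun_const)

lemma algebraic_set_Un:
  assumes "algebraic_set A" "algebraic_set B"
  shows "algebraic_set (A \<union> B)"
proof -
  obtain S T where S: "S \<subseteq> Collect polyfun" "A = zero_locus S"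
    and T: "T \<subseteq> Collect polyfun" "B = zero_locus T"
    using assms unfolding algebraic_set_def by blast
  let ?P = "{\<lambda>x. f x * g x | f g. f \<in> S \<and> g \<in> T}"
  have "?P \<subseteq> Collect polyfun"
    using S(1) T(1) by (auto intro: polyfun_mult)
  moreover have "A \<union> B = zero_locus ?P"
  proof
    show "A \<union> B \<subseteq> zero_locus ?P"
      unfolding S(2) T(2) zero_locus_def by auto
    show "zero_locus ?P \<subseteq> A \<union> B"
    proof
      fix x assume "x \<in> zero_locus ?P"
      then have *: "f x * g x = 0" if "f \<in> S" "g \<in> T" for f g
        using that unfolding zero_locus_def mem_Collect_eq by (elim ballE[of _ _ "\<lambda>x. f x * g x"]) auto
      show "x \<in> A \<union> B"
      proof (rule ccontr)
        assume "x \<notin> A \<union> B"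
        then obtain f g where "f \<in> S" "f x \<noteq> 0" "g \<in> T" "g x \<noteq> 0"
          unfolding S(2) T(2) zero_locus_def by blast
        then show False
          using * by auto
      qed
    qed
  qed
  ultimately show ?thesis
    unfolding algebraic_set_def by blast
qed

lemma algebraic_set_Inter:
  assumes "\<And>A. A \<in> \<A> \<Longrightarrow> algebraic_set A"
  shows "algebraic_set (\<Inter>\<A>)"
proof -
  let ?S = "{f. polyfun f \<and> (\<exists>A\<in>\<A>. \<forall>x\<in>A. f x = 0)}"
  have "x \<in> A" if x: "x \<in> zero_locus ?S" and A: "A \<in> \<A>" for x A
  proof -
    obtain S where S: "S \<subseteq> Collect polyfun" "A = zero_locus S"
      using assms[OF A] unfolding algebraic_set_def by blast
    have "S \<subseteq> ?S"
    proof
      fix f assume "f \<in> S"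
      then have "polyfun f" "\<forall>x\<in>A. f x = 0"
        using S by (auto simp: zero_locus_def)
      then show "f \<in> ?S"
        using A by blast
    qed
    then show ?thesis
      using x unfolding S(2) zero_locus_def by blast
  qed
  moreover have "x \<in> zero_locus ?S" if "x \<in> \<Inter>\<A>" for x
    using that unfolding zero_locus_def by blast
  ultimately have "\<Inter>\<A> = zero_locus ?S"
    by blast
  then show ?thesis
    unfolding algebraic_set_def by (intro exI[of _ ?S]) auto
qed

lemma openin_zariski:
  fixes U :: "('k::field ^ 'n) set"
  shows "openin zariski U \<longleftrightarrow> algebraic_set (- U)"
proof -
  have "istopology (\<lambda>U::('k ^ 'n) set. algebraic_set (- U))"
    unfolding istopology_def
  proof (intro conjI allI impI)
    fix S T :: "('k ^ 'n) set"
    assume "algebraic_set (- S)" "algebraic_set (- T)"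
    then show "algebraic_set (- (S \<inter> T))"
      by (simp add: algebraic_set_Un Compl_Int)
  next
    fix \<K> :: "('k ^ 'n) set set"
    assume "\<forall>K\<in>\<K>. algebraic_set (- K)"
    then have "algebraic_set (\<Inter>(uminus ` \<K>))"
      by (intro algebraic_set_Inter) auto
    then show "algebraic_set (- \<Union>\<K>)"
      by (simp add: uminus_Sup)
  qed
  then show ?thesis
    unfolding zariski_def by (simp add: topology_inverse')
qed

lemma topspace_zariski [simp]: "topspace zariski = UNIV"
proof -
  have "openin zariski (UNIV :: ('k::field ^ 'n) set)"
    by (simp add: openin_zariski algebraic_set_empty)
  then show ?thesis
    using openin_subset by blast
qed

lemma closedin_zariski: "closedin zariski Z \<longleftrightarrow> algebraic_set Z"
  by (simp add: closedin_def openin_zariski Compl_eq_Diff_UNIV [symmetric])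

section \<open>Irreducibility and dimension\<close>

definition irreducible_space :: "'a topology \<Rightarrow> bool" where
  "irreducible_space X \<longleftrightarrow> topspace X \<noteq> {} \<and>
     (\<forall>A B. closedin X A \<and> closedin X B \<and> A \<union> B = topspace X \<longrightarrow>
        A = topspace X \<or> B = topspace X)"

text \<open>The Krull dimension of a topological space. The empty space has dimension
  \<open>-\<infinity>\<close>, the supremum of the empty set.\<close>

definition krull_dim :: "'a topology \<Rightarrow> ereal" where
  "krull_dim X = Sup {ereal (real n) | n.
     \<exists>Z :: nat \<Rightarrow> 'a set.
       (\<forall>i\<le>n. closedin X (Z i) \<and> irreducible_space (subtopology X (Z i))) \<and>
       (\<forall>i<n. Z i \<subset> Z (Suc i))}"

definition zariski_dim :: "('k::field ^ 'n) set \<Rightarrow> ereal" where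
  "zariski_dim V = krull_dim (subtopology zariski V)"

section \<open>The augmented map\<close>

abbreviation cpoly :: "int poly \<Rightarrow> complex poly" where
  "cpoly \<equiv> map_poly of_int"

definition lead_ratio :: "int poly \<Rightarrow> int poly \<Rightarrow> complex" where
  "lead_ratio \<phi>1 \<phi>2 = of_int (lead_coeff \<phi>2) / of_int (lead_coeff \<phi>1)"

definition D_poly :: "int poly \<Rightarrow> int poly \<Rightarrow> complex poly" where
  "D_poly \<phi>1 \<phi>2 = cpoly \<phi>2 - smult (lead_ratio \<phi>1 \<phi>2) (cpoly \<phi>1)"

definition W_set :: "int poly \<Rightarrow> (complex ^ 4) set" where
  "W_set \<phi>1 = {y. poly (cpoly \<phi>1) (y $ 1) - poly (cpoly \<phi>1) (y $ 2) =
                  poly (cpoly \<phi>1) (y $ 3) - poly (cpoly \<phi>1) (y $ 4)}"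

text \<open>The formulas make sense on all of affine 4-space; the map is only ever considered
  on \<open>W_set \<phi>1\<close>.\<close>

definition aug_map :: "int poly \<Rightarrow> int poly \<Rightarrow> complex ^ 4 \<Rightarrow> complex ^ 3" where
  "aug_map \<phi>1 \<phi>2 y = vector
     [poly (D_poly \<phi>1 \<phi>2) (y $ 4) - poly (D_poly \<phi>1 \<phi>2) (y $ 2),
      poly (cpoly \<phi>2) (y $ 1) - poly (cpoly \<phi>2) (y $ 2),
      poly (cpoly \<phi>2) (y $ 4) - poly (cpoly \<phi>2) (y $ 3)]"

definition aug_fibre :: "int poly \<Rightarrow> int poly \<Rightarrow> complex ^ 3 \<Rightarrow> (complex ^ 4) set" where
  "aug_fibre \<phi>1 \<phi>2 p = {y \<in> W_set \<phi>1. aug_map \<phi>1 \<phi>2 y = p}"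

end

theory Submission
  imports Defs "Jordan_Normal_Form.Char_Poly"
begin

text \<open>
  On a fibre of the map, \<open>y\<^sub>2\<close> determines the other coordinates up to finitely many choices,
  and it does so through monic equations. The polynomial
  \<open>D\<close> vanishes at the origin, and it is not zero because \<open>\<phi>\<^sub>1\<close> and
  \<open>\<phi>\<^sub>2\<close> are linearly independent; so it is not constant. On the fibre over
  \<open>(c, u, v)\<close> the three equations
  \<open>D(y\<^sub>4) = D(y\<^sub>2) + c\<close>, \<open>\<phi>\<^sub>2(y\<^sub>1) = \<phi>\<^sub>2(y\<^sub>2) + u\<close> and \<open>\<phi>\<^sub>2(y\<^sub>3) = \<phi>\<^sub>2(y\<^sub>4) - v\<close>
  therefore make \<open>y\<^sub>4\<close>, \<open>y\<^sub>1\<close> and then \<open>y\<^sub>3\<close> integral over the ring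
  of polynomials in \<open>y\<^sub>2\<close> (lemma \<open>integral_over_coordinates_aug_fibre\<close>).

  A set all of whose coordinates are integral over one polynomial function \<open>\<tau>\<close> has dimension
  at most one (lemma \<open>zariski_dim_le_1_if_integral_over_parameter\<close>). Indeed every polynomial
  function on it is integral over \<open>\<tau>\<close>. Let \<open>Y\<close> be a proper closed subset of an irreducible
  closed set \<open>Z\<close>, and let \<open>f\<close> vanish on \<open>Y\<close> but not on \<open>Z\<close>. After division by the highest
  power of the unknown that divides it, which is permitted because \<open>Z\<close> is irreducible, a monic
  relation for \<open>f\<close> has a nonzero constant term \<open>a(\<tau>)\<close>, and this term vanishes on \<open>Y\<close>.
  So \<open>\<tau>\<close>, and with it every coordinate, takes finitely many values on \<open>Y\<close>
  (lemma \<open>finite_proper_closed_subset\<close>). In a chain of three irreducible closed sets the middle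
  one would be finite, hence a single point, which leaves no room for the smallest.
\<close>

(* Here smult is scalar multiplication of polynomials and $ selects a coordinate in affine space. *)
hide_const (open) Module.smult
no_notation Matrix.vec_index (infixl "$" 100)

section \<open>Functions integral over one parameter\<close>

text \<open>The coefficients of \<open>P\<close> are polynomials in the parameter, so that
  \<open>poly (poly P [:x:]) t\<close> is the value of the bivariate polynomial \<open>P\<close> when its outer variable is
  \<open>x\<close> and its inner one is \<open>t\<close>.\<close>

definition integral_over :: "'a set \<Rightarrow> ('a \<Rightarrow> 'k::field) \<Rightarrow> ('a \<Rightarrow> 'k) \<Rightarrow> bool" where
  "integral_over V \<tau> g \<longleftrightarrow>
     (\<exists>P. lead_coeff P = 1 \<and> (\<forall>z\<in>V. poly (poly P [:g z:]) (\<tau> z) = 0))"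

lemma poly_poly_const_altdef:
  fixes P :: "'k::comm_ring_1 poly poly"
  shows "poly (poly P [:x:]) t = (\<Sum>i\<le>degree P. poly (coeff P i) t * x ^ i)"
  by (simp add: poly_altdef[of P] poly_sum flip: poly_const_pow)

lemma poly_map_poly_poly:
  fixes P :: "'k::comm_ring_1 poly poly"
  shows "poly (map_poly (\<lambda>p. poly p t) P) x = poly (poly P [:x:]) t"
  by (induction P) (auto simp: map_poly_pCons)

text \<open>The module that the functions \<open>b i\<close> generate over the ring of polynomials in \<open>\<tau>\<close>. Functions
  are compared on \<open>V\<close> only, because the relations that will be used hold only there.\<close>

definition coeff_span ::
  "'a set \<Rightarrow> ('a \<Rightarrow> 'k::field) \<Rightarrow> 'i set \<Rightarrow> ('i \<Rightarrow> 'a \<Rightarrow> 'k) \<Rightarrow> ('a \<Rightarrow> 'k) set" where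
  "coeff_span V \<tau> I b =
     {f. \<exists>c. \<forall>z\<in>V. f z = (\<Sum>j\<in>I. poly (c j) (\<tau> z) * b j z)}"

lemma coeff_span_cong:
  assumes "\<And>z. z \<in> V \<Longrightarrow> f z = g z" and "f \<in> coeff_span V \<tau> I b"
  shows "g \<in> coeff_span V \<tau> I b"
  using assms unfolding coeff_span_def by auto

lemma coeff_span_base:
  assumes "finite I" and "i \<in> I"
  shows "b i \<in> coeff_span V \<tau> I b"
  unfolding coeff_span_def mem_Collect_eq
proof (intro exI ballI)
  fix z
  have "(\<Sum>j\<in>I. poly (if j = i then 1 else 0) (\<tau> z) * b j z) = (\<Sum>j\<in>I. if j = i then b j z else 0)"
    by (intro sum.cong) auto
  then show "b i z = (\<Sum>j\<in>I. poly (if j = i then 1 else 0) (\<tau> z) * b j z)"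
    using assms by simp
qed

lemma coeff_span_add:
  assumes "f \<in> coeff_span V \<tau> I b" and "g \<in> coeff_span V \<tau> I b"
  shows "(\<lambda>z. f z + g z) \<in> coeff_span V \<tau> I b"
proof -
  obtain c d where "\<forall>z\<in>V. f z = (\<Sum>j\<in>I. poly (c j) (\<tau> z) * b j z)"
    and "\<forall>z\<in>V. g z = (\<Sum>j\<in>I. poly (d j) (\<tau> z) * b j z)"
    using assms unfolding coeff_span_def by blast
  then have "\<forall>z\<in>V. f z + g z = (\<Sum>j\<in>I. poly (c j + d j) (\<tau> z) * b j z)"
    by (simp add: sum.distrib distrib_right)
  then show ?thesis
    unfolding coeff_span_def by (intro CollectI exI[of _ "\<lambda>j. c j + d j"])
qed

lemma coeff_span_scale:
  assumes "f \<in> coeff_span V \<tau> I b"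
  shows "(\<lambda>z. poly p (\<tau> z) * f z) \<in> coeff_span V \<tau> I b"
proof -
  obtain c where "\<forall>z\<in>V. f z = (\<Sum>j\<in>I. poly (c j) (\<tau> z) * b j z)"
    using assms unfolding coeff_span_def by blast
  then have "\<forall>z\<in>V. poly p (\<tau> z) * f z = (\<Sum>j\<in>I. poly (p * c j) (\<tau> z) * b j z)"
    by (simp add: sum_distrib_left mult.assoc)
  then show ?thesis
    unfolding coeff_span_def by (intro CollectI exI[of _ "\<lambda>j. p * c j"])
qed

lemma coeff_span_sum:
  assumes "finite J" and "\<And>j. j \<in> J \<Longrightarrow> f j \<in> coeff_span V \<tau> I b"
  shows "(\<lambda>z. \<Sum>j\<in>J. f j z) \<in> coeff_span V \<tau> I b"
  using assms
proof (induction J rule: finite_induct)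
  case empty
  show ?case
    unfolding coeff_span_def by (auto intro!: exI[of _ "\<lambda>_. 0"])
next
  case (insert j J)
  have "(\<lambda>z. f j z + (\<Sum>j\<in>J. f j z)) \<in> coeff_span V \<tau> I b"
    by (intro coeff_span_add insert) (auto intro: insert)
  then show ?case
    using insert.hyps by simp
qed

lemma coeff_span_mult_closed:
  assumes fin: "finite I"
    and g: "\<And>i. i \<in> I \<Longrightarrow> (\<lambda>z. g z * b i z) \<in> coeff_span V \<tau> I b"
    and f: "f \<in> coeff_span V \<tau> I b"
  shows "(\<lambda>z. g z * f z) \<in> coeff_span V \<tau> I b"
proof -
  obtain c where c: "\<forall>z\<in>V. f z = (\<Sum>j\<in>I. poly (c j) (\<tau> z) * b j z)"
    using f unfolding coeff_span_def by blast
  have "(\<lambda>z. \<Sum>j\<in>I. poly (c j) (\<tau> z) * (g z * b j z)) \<in> coeff_span V \<tau> I b"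
    by (intro coeff_span_sum[OF fin] coeff_span_scale g)
  moreover have "(\<Sum>j\<in>I. poly (c j) (\<tau> z) * (g z * b j z)) = g z * f z" if "z \<in> V" for z
    using c that by (simp add: sum_distrib_left mult_ac)
  ultimately show ?thesis
    by (rule coeff_span_cong[rotated])
qed

text \<open>The determinant trick: on \<open>V\<close>, multiplication by \<open>f\<close> acts on the vector of generators
  by a matrix of polynomials in \<open>\<tau>\<close>. At each point that vector is an eigenvector with eigenvalue
  \<open>f z\<close>, so the characteristic polynomial, which is monic, vanishes there.\<close>

lemma integral_over_of_finite_module:
  fixes f :: "'a \<Rightarrow> 'k::field"
  assumes fin: "finite I"
    and nz: "\<And>z. z \<in> V \<Longrightarrow> \<exists>i\<in>I. b i z \<noteq> 0"
    and stable: "\<And>i. i \<in> I \<Longrightarrow> (\<lambda>z. f z * b i z) \<in> coeff_span V \<tau> I b"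
  shows "integral_over V \<tau> f"
proof -
  have "\<exists>c. \<forall>z\<in>V. f z * b i z = (\<Sum>j\<in>I. poly (c j) (\<tau> z) * b j z)" if "i \<in> I" for i
    using stable[OF that] unfolding coeff_span_def by simp
  then obtain a where a:
    "\<And>i z. i \<in> I \<Longrightarrow> z \<in> V \<Longrightarrow> f z * b i z = (\<Sum>j\<in>I. poly (a i j) (\<tau> z) * b j z)"
    by metis
  define n where "n = card I"
  obtain h where h: "bij_betw h {0..<n} I"
    using ex_bij_betw_nat_finite[OF fin] unfolding n_def by blast
  define A where "A = Matrix.mat n n (\<lambda>(i, j). a (h i) (h j))"
  have A: "A \<in> carrier_mat n n"
    by (simp add: A_def)
  have "poly (poly (char_poly A) [:f z:]) (\<tau> z) = 0" if z: "z \<in> V" for z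
  proof -
    define E where "E = (\<lambda>p. poly p (\<tau> z))"
    interpret E: comm_ring_hom E
      by unfold_locales (auto simp: E_def)
    define v where "v = Matrix.vec n (\<lambda>i. b (h i) z)"
    have EA: "map_mat E A \<in> carrier_mat n n"
      using A by simp
    have hI: "h i \<in> I" if "i < n" for i
      using h that by (auto simp: bij_betw_def)
    have "eigenvector (map_mat E A) v (f z)"
      unfolding eigenvector_def
    proof (intro conjI)
      show "v \<in> carrier_vec (dim_row (map_mat E A))"
        by (simp add: v_def A_def)
      obtain i where "i \<in> I" "b i z \<noteq> 0"
        using nz[OF z] by blast
      then obtain k where "k < n" "h k = i"
        using h by (auto simp: bij_betw_def)
      then have "vec_index v k \<noteq> vec_index (0\<^sub>v n) k"
        using \<open>b i z \<noteq> 0\<close> by (simp add: v_def)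
      then show "v \<noteq> 0\<^sub>v (dim_row (map_mat E A))"
        by (auto simp: A_def)
      show "map_mat E A *\<^sub>v v = f z \<cdot>\<^sub>v v"
      proof (rule eq_vecI)
        show "dim_vec (map_mat E A *\<^sub>v v) = dim_vec (f z \<cdot>\<^sub>v v)"
          by (simp add: v_def A_def)
        fix i assume "i < dim_vec (f z \<cdot>\<^sub>v v)"
        then have i: "i < n"
          by (simp add: v_def)
        have "vec_index (map_mat E A *\<^sub>v v) i = (\<Sum>j\<in>{0..<n}. E (a (h i) (h j)) * b (h j) z)"
          using i by (simp add: A_def v_def scalar_prod_def)
        also have "\<dots> = (\<Sum>j\<in>I. E (a (h i) j) * b j z)"
          by (rule sum.reindex_bij_betw[OF h])
        also have "\<dots> = f z * b (h i) z"
          using a[OF hI[OF i] z] by (simp add: E_def)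
        finally show "vec_index (map_mat E A *\<^sub>v v) i = vec_index (f z \<cdot>\<^sub>v v) i"
          using i by (simp add: v_def)
      qed
    qed
    then have "poly (char_poly (map_mat E A)) (f z) = 0"
      using eigenvalue_root_char_poly[OF EA] unfolding eigenvalue_def by blast
    then show ?thesis
      unfolding E.char_poly_hom[OF A] unfolding E_def poly_map_poly_poly .
  qed
  then show ?thesis
    using degree_monic_char_poly[OF A] unfolding integral_over_def by auto
qed

lemma monic_relation_power:
  fixes P :: "'k::comm_ring_1 poly poly"
  assumes "lead_coeff P = 1" and "poly (poly P [:x:]) t = 0"
  shows "x ^ degree P = (\<Sum>i<degree P. poly (- coeff P i) t * x ^ i)"
proof -
  have split: "{..degree P} = insert (degree P) {..<degree P}"
    by auto
  have "(\<Sum>i<degree P. poly (coeff P i) t * x ^ i) + x ^ degree P = 0"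
    using assms poly_poly_const_altdef[of P x t] unfolding split by (simp add: add.commute)
  then show ?thesis
    by (simp add: sum_negf eq_neg_iff_add_eq_0 add.commute)
qed

text \<open>The monic relations for \<open>g\<close> and \<open>h\<close> reduce high powers, so the finitely many products
  \<open>g ^ i * h ^ j\<close> with small exponents generate a module that is stable under multiplication by
  both functions, hence by their sum and product.\<close>

lemma integral_over_add_mult:
  fixes g h :: "'a \<Rightarrow> 'k::field"
  assumes "integral_over V \<tau> g" and "integral_over V \<tau> h"
  shows "integral_over V \<tau> (\<lambda>z. g z + h z)" and "integral_over V \<tau> (\<lambda>z. g z * h z)"
proof -
  obtain P where P: "lead_coeff P = 1" "\<And>z. z \<in> V \<Longrightarrow> poly (poly P [:g z:]) (\<tau> z) = 0"
    using assms(1) unfolding integral_over_def by blast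
  obtain Q where Q: "lead_coeff Q = 1" "\<And>z. z \<in> V \<Longrightarrow> poly (poly Q [:h z:]) (\<tau> z) = 0"
    using assms(2) unfolding integral_over_def by blast
  define m n where "m = degree P" and "n = degree Q"
  define I where "I = {..<m} \<times> {..<n}"
  define b where "b = (\<lambda>(i, j) z. g z ^ i * h z ^ j)"
  let ?M = "coeff_span V \<tau> I b"
  have fin: "finite I"
    by (simp add: I_def)
  have base: "(\<lambda>z. g z ^ i * h z ^ j) \<in> ?M" if "i < m" "j < n" for i j
    using coeff_span_base[OF fin, of "(i, j)" b V \<tau>] that by (simp add: I_def b_def)
  have nz: "\<exists>i\<in>I. b i z \<noteq> 0" if z: "z \<in> V" for z
  proof -
    \<comment> \<open>A monic polynomial of degree 0 has no roots, so both degrees are positive.\<close>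
    have "m \<noteq> 0"
      using P(1) P(2)[OF z] unfolding m_def
      by (metis degree_eq_zeroE lead_coeff_pCons(2) pCons_one poly_1 zero_neq_one)
    moreover have "n \<noteq> 0"
      using Q(1) Q(2)[OF z] unfolding n_def
      by (metis degree_eq_zeroE lead_coeff_pCons(2) pCons_one poly_1 zero_neq_one)
    ultimately show ?thesis
      by (intro bexI[of _ "(0, 0)"]) (auto simp: b_def I_def)
  qed
  have g: "(\<lambda>z. g z * b ij z) \<in> ?M" if "ij \<in> I" for ij
  proof -
    obtain i j where ij: "ij = (i, j)" "i < m" "j < n"
      using \<open>ij \<in> I\<close> unfolding I_def by auto
    have "(\<lambda>z. g z ^ Suc i * h z ^ j) \<in> ?M"
    proof (cases "Suc i = m")
      case True
      have "(\<lambda>z. \<Sum>k<m. poly (- coeff P k) (\<tau> z) * (g z ^ k * h z ^ j)) \<in> ?M"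
        by (intro coeff_span_sum coeff_span_scale base) (use ij in auto)
      moreover have "(\<Sum>k<m. poly (- coeff P k) (\<tau> z) * (g z ^ k * h z ^ j)) = g z ^ Suc i * h z ^ j"
        if "z \<in> V" for z
        unfolding True unfolding m_def monic_relation_power[OF P(1) P(2)[OF that]]
        by (simp only: sum_distrib_right mult.assoc)
      ultimately show ?thesis
        by (rule coeff_span_cong[rotated])
    next
      case False
      then show ?thesis
        by (intro base[of "Suc i" j]) (use ij in auto)
    qed
    then show ?thesis
      by (simp add: ij(1) b_def mult.assoc)
  qed
  have h: "(\<lambda>z. h z * b ij z) \<in> ?M" if "ij \<in> I" for ij
  proof -
    obtain i j where ij: "ij = (i, j)" "i < m" "j < n"
      using \<open>ij \<in> I\<close> unfolding I_def by auto
    have "(\<lambda>z. g z ^ i * h z ^ Suc j) \<in> ?M"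
    proof (cases "Suc j = n")
      case True
      have "(\<lambda>z. \<Sum>k<n. poly (- coeff Q k) (\<tau> z) * (g z ^ i * h z ^ k)) \<in> ?M"
        by (intro coeff_span_sum coeff_span_scale base) (use ij in auto)
      moreover have "(\<Sum>k<n. poly (- coeff Q k) (\<tau> z) * (g z ^ i * h z ^ k)) = g z ^ i * h z ^ Suc j"
        if "z \<in> V" for z
        unfolding True unfolding n_def monic_relation_power[OF Q(1) Q(2)[OF that]]
        by (simp only: sum_distrib_left mult.left_commute)
      ultimately show ?thesis
        by (rule coeff_span_cong[rotated])
    next
      case False
      then show ?thesis
        by (intro base[of i "Suc j"]) (use ij in auto)
    qed
    then show ?thesis
      by (simp add: ij(1) b_def mult_ac)
  qed
  show "integral_over V \<tau> (\<lambda>z. g z + h z)"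
    using fin nz
  proof (rule integral_over_of_finite_module)
    show "(\<lambda>z. (g z + h z) * b i z) \<in> ?M" if "i \<in> I" for i
      using coeff_span_add[OF g[OF that] h[OF that]] by (simp add: distrib_right)
  qed
  show "integral_over V \<tau> (\<lambda>z. g z * h z)"
    using fin nz
  proof (rule integral_over_of_finite_module)
    show "(\<lambda>z. (g z * h z) * b i z) \<in> ?M" if "i \<in> I" for i
      using coeff_span_mult_closed[OF fin g h[OF that]] by (simp add: mult.assoc)
  qed
qed

lemma integral_over_parameter: "integral_over V \<tau> (\<lambda>z. poly p (\<tau> z))"
  unfolding integral_over_def by (intro exI[of _ "[:- p, 1:]"]) simp

lemma integral_over_const: "integral_over V \<tau> (\<lambda>z. c)"
  using integral_over_parameter[of V \<tau> "[:c:]"] by simp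

lemma integral_over_poly:
  assumes "integral_over V \<tau> g"
  shows "integral_over V \<tau> (\<lambda>z. poly q (g z))"
proof (induction q)
  case 0
  show ?case
    using integral_over_const[of V \<tau> 0] by simp
next
  case (pCons a q)
  have "integral_over V \<tau> (\<lambda>z. a + g z * poly q (g z))"
    by (intro integral_over_add_mult integral_over_const assms pCons)
  then show ?case
    by simp
qed

lemma integral_over_cong:
  assumes "\<And>z. z \<in> V \<Longrightarrow> f z = g z" and "integral_over V \<tau> f"
  shows "integral_over V \<tau> g"
  using assms unfolding integral_over_def by auto

text \<open>Substitution of \<open>q\<close> for the unknown in a monic relation for \<open>q(g)\<close> gives a relation for
  \<open>g\<close> whose leading coefficient is a nonzero constant.\<close>

lemma integral_over_of_poly:
  assumes q: "degree q > 0" and int: "integral_over V \<tau> (\<lambda>z. poly q (g z))"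
  shows "integral_over V \<tau> g"
proof -
  obtain P where P: "lead_coeff P = 1" "\<And>z. z \<in> V \<Longrightarrow> poly (poly P [:poly q (g z):]) (\<tau> z) = 0"
    using int unfolding integral_over_def by blast
  define q' where "q' = map_poly (\<lambda>c. [:c:]) q"
  define l where "l = lead_coeff q ^ degree P"
  have deg: "degree q' = degree q"
    unfolding q'_def by (rule degree_map_poly) simp
  have lead: "lead_coeff (pcompose P q') = [:l:]"
    using q P(1) deg by (subst lead_coeff_comp) (simp_all add: q'_def l_def coeff_map_poly poly_const_pow)
  have q': "poly q' [:x:] = [:poly q x:]" for x
    unfolding q'_def by (induction q) (auto simp: map_poly_pCons)
  have "l \<noteq> 0"
    using q by (auto simp: l_def)
  then have "lead_coeff (smult [:inverse l:] (pcompose P q')) = 1"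
    using lead by (simp add: pCons_one)
  moreover have "poly (poly (smult [:inverse l:] (pcompose P q')) [:g z:]) (\<tau> z) = 0"
    if "z \<in> V" for z
    using P(2)[OF that] by (simp add: poly_pcompose q')
  ultimately show ?thesis
    unfolding integral_over_def by blast
qed

text \<open>A monic relation stays nonzero for every value of the parameter.\<close>

lemma integral_over_finite_values:
  assumes "integral_over V \<tau> g" and "finite (\<tau> ` V)"
  shows "finite (g ` V)"
proof -
  obtain P where P: "lead_coeff P = 1" "\<And>z. z \<in> V \<Longrightarrow> poly (poly P [:g z:]) (\<tau> z) = 0"
    using assms(1) unfolding integral_over_def by blast
  define R where "R = (\<lambda>t. map_poly (\<lambda>p. poly p t) P)"
  have "R t \<noteq> 0" for t
  proof -
    have "coeff (R t) (degree P) = 1"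
      using P(1) by (simp add: R_def coeff_map_poly)
    then show ?thesis
      by auto
  qed
  then have "finite (\<Union>t\<in>\<tau> ` V. {x. poly (R t) x = 0})"
    using assms(2) by (intro finite_UN_I poly_roots_finite)
  moreover have "g ` V \<subseteq> (\<Union>t\<in>\<tau> ` V. {x. poly (R t) x = 0})"
    using P(2) by (auto simp: R_def poly_map_poly_poly)
  ultimately show ?thesis
    by (rule finite_subset[rotated])
qed

section \<open>Irreducible closed sets over one parameter\<close>

lemma polyfun_poly:
  assumes "polyfun f"
  shows "polyfun (\<lambda>x. poly p (f x))"
proof (induction p)
  case 0
  show ?case
    using polyfun_const[of 0] by simp
next
  case (pCons a p)
  have "polyfun (\<lambda>x. a + f x * poly p (f x))"
    by (intro polyfun.intros assms pCons)
  then show ?case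
    by simp
qed

lemma polyfun_poly_poly:
  assumes "polyfun f" and "polyfun g"
  shows "polyfun (\<lambda>x. poly (poly P [:f x:]) (g x))"
proof (induction P)
  case 0
  show ?case
    using polyfun_const[of 0] by simp
next
  case (pCons a P)
  have "polyfun (\<lambda>x. poly a (g x) + f x * poly (poly P [:f x:]) (g x))"
    by (intro polyfun.intros assms pCons polyfun_poly)
  then show ?case
    by simp
qed

lemma polyfun_power:
  assumes "polyfun f"
  shows "polyfun (\<lambda>x. f x ^ n)"
  using polyfun_poly[OF assms, of "Polynomial.monom 1 n"] by (simp add: poly_monom)

lemma integral_over_polyfun:
  assumes "\<And>i. integral_over V \<tau> (\<lambda>z. z $ i)" and "polyfun f"
  shows "integral_over V \<tau> f"
  using assms(2)
  by induction (auto intro: assms(1) integral_over_const integral_over_add_mult)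

lemma closedin_zero_locus:
  assumes "polyfun f"
  shows "closedin zariski {x. f x = 0}"
  unfolding closedin_zariski algebraic_set_def
  by (rule exI[of _ "{f}"]) (use assms in \<open>auto simp: zero_locus_def\<close>)

text \<open>The ring of polynomial functions on an irreducible set has no zero divisors, because the
  zero sets of two factors of zero cover the set.\<close>

lemma irreducible_mult_zero:
  assumes irr: "irreducible_space (subtopology zariski Z)"
    and fg: "polyfun f" "polyfun g" "\<And>z. z \<in> Z \<Longrightarrow> f z * g z = 0"
  shows "(\<forall>z\<in>Z. f z = 0) \<or> (\<forall>z\<in>Z. g z = 0)"
proof -
  let ?A = "Z \<inter> {x. f x = 0}" and ?B = "Z \<inter> {x. g x = 0}"
  have "closedin (subtopology zariski Z) ?A" "closedin (subtopology zariski Z) ?B"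
    using fg by (auto intro!: closedin_subtopology_Int_closed closedin_zero_locus)
  moreover have "?A \<union> ?B = topspace (subtopology zariski Z)"
    using fg(3) by auto
  ultimately have "?A = Z \<or> ?B = Z"
    using irr unfolding irreducible_space_def by simp
  then show ?thesis
    by blast
qed

lemma closedin_zariski_finite:
  fixes S :: "('k::field ^ 'n) set"
  assumes "finite S"
  shows "closedin zariski S"
  using assms
proof (induction S rule: finite_induct)
  case (insert a S)
  let ?F = "range (\<lambda>i x. x $ i + (- (a $ i)))"
  have "?F \<subseteq> Collect polyfun"
    using polyfun_add[OF polyfun_coord polyfun_const] by blast
  moreover have "{a} = zero_locus ?F"
    by (auto simp: zero_locus_def Finite_Cartesian_Product.vec_eq_iff)
  ultimately have "closedin zariski {a}"
    unfolding closedin_zariski algebraic_set_def by blast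
  then show ?case
    using closedin_Un[OF _ insert.IH, of "{a}"] by simp
qed simp

text \<open>Write a monic relation as \<open>X ^ k * Q\<close> with \<open>k\<close> maximal. On \<open>Z\<close> the product
  \<open>f ^ k * Q(f)\<close> is zero and \<open>f ^ k\<close> is not, so \<open>Q\<close> is again a relation for \<open>f\<close>.\<close>

lemma integral_relation_nonzero_constant:
  fixes Z :: "('k::field ^ 'n) set"
  assumes irr: "irreducible_space (subtopology zariski Z)"
    and \<tau>: "polyfun \<tau>" and f: "polyfun f" and int: "integral_over Z \<tau> f"
    and nz: "z0 \<in> Z" "f z0 \<noteq> 0"
  shows "\<exists>Q. poly Q 0 \<noteq> 0 \<and> (\<forall>z\<in>Z. poly (poly Q [:f z:]) (\<tau> z) = 0)"
proof -
  obtain P where P: "lead_coeff P = 1" "\<And>z. z \<in> Z \<Longrightarrow> poly (poly P [:f z:]) (\<tau> z) = 0"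
    using int unfolding integral_over_def by blast
  have "P \<noteq> 0"
    using P(1) by auto
  then obtain k Q where Q: "P = [:0, 1:] ^ k * Q" "\<not> [:0, 1:] dvd Q"
    using order_decomp[of P 0] by auto
  have "f z ^ k * poly (poly Q [:f z:]) (\<tau> z) = 0" if "z \<in> Z" for z
    using P(2)[OF that] unfolding Q(1) by simp
  then have "(\<forall>z\<in>Z. f z ^ k = 0) \<or> (\<forall>z\<in>Z. poly (poly Q [:f z:]) (\<tau> z) = 0)"
    by (intro irreducible_mult_zero[OF irr] polyfun_power polyfun_poly_poly f \<tau>)
  moreover have "\<not> (\<forall>z\<in>Z. f z ^ k = 0)"
    using nz by auto
  moreover have "poly Q 0 \<noteq> 0"
    using Q(2) by (simp add: poly_eq_0_iff_dvd)
  ultimately show ?thesis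
    by blast
qed

lemma finite_of_finite_coordinates:
  fixes Y :: "('a ^ 'n) set"
  assumes "\<And>i. finite ((\<lambda>z. z $ i) ` Y)"
  shows "finite Y"
proof (rule finite_imageD)
  show "finite (vec_nth ` Y)"
  proof (rule finite_subset)
    show "vec_nth ` Y \<subseteq> Pi\<^sub>E UNIV (\<lambda>i. (\<lambda>z. z $ i) ` Y)"
      by auto
    show "finite (Pi\<^sub>E UNIV (\<lambda>i. (\<lambda>z. z $ i) ` Y))"
      using assms by (intro finite_PiE) auto
  qed
  show "inj_on vec_nth Y"
    by (auto simp: inj_on_def Finite_Cartesian_Product.vec_eq_iff)
qed

lemma integral_over_subset:
  "integral_over V \<tau> f \<Longrightarrow> U \<subseteq> V \<Longrightarrow> integral_over U \<tau> f"
  unfolding integral_over_def by blast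

text \<open>This is the fact that bounds the dimension. For a polynomial function \<open>f\<close> that vanishes on
  \<open>Y\<close> but not on \<open>Z\<close>, the relation of the lemma \<open>integral_relation_nonzero_constant\<close> reduces on
  \<open>Y\<close> to a nonzero polynomial equation in \<open>\<tau>\<close> alone.\<close>

lemma finite_proper_closed_subset:
  fixes V Y Z :: "('k::field ^ 'n) set"
  assumes \<tau>: "polyfun \<tau>" and int: "\<And>i. integral_over V \<tau> (\<lambda>z. z $ i)"
    and Y: "closedin (subtopology zariski V) Y"
    and Z: "Z \<subseteq> V" "irreducible_space (subtopology zariski Z)"
    and YZ: "Y \<subset> Z"
  shows "finite Y"
proof -
  obtain S where S: "S \<subseteq> Collect polyfun" "Y = V \<inter> zero_locus S"
    using Y by (auto simp: closedin_subtopology closedin_zariski algebraic_set_def)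
  obtain z0 where "z0 \<in> Z" "z0 \<notin> zero_locus S"
    using YZ S(2) Z(1) by blast
  then obtain f where f: "f \<in> S" "f z0 \<noteq> 0"
    unfolding zero_locus_def by blast
  have pf: "polyfun f"
    using f(1) S(1) by blast
  have fY: "f y = 0" if "y \<in> Y" for y
    using that f(1) S(2) by (auto simp: zero_locus_def)
  have "integral_over Z \<tau> f"
    using integral_over_subset[OF integral_over_polyfun[OF int pf] Z(1)] .
  then obtain Q where Q: "poly Q 0 \<noteq> 0" "\<And>z. z \<in> Z \<Longrightarrow> poly (poly Q [:f z:]) (\<tau> z) = 0"
    using integral_relation_nonzero_constant[OF Z(2) \<tau> pf _ \<open>z0 \<in> Z\<close> f(2)] by blast
  have "poly (poly Q 0) (\<tau> y) = 0" if "y \<in> Y" for y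
    using Q(2)[of y] fY[OF that] that YZ by auto
  then have "\<tau> ` Y \<subseteq> {t. poly (poly Q 0) t = 0}"
    by blast
  then have "finite (\<tau> ` Y)"
    using poly_roots_finite[OF Q(1)] finite_subset by blast
  then have "finite ((\<lambda>z. z $ i) ` Y)" for i
    using integral_over_finite_values[OF integral_over_subset[OF int]] YZ Z(1)
    by (metis psubset_imp_subset subset_trans)
  then show ?thesis
    by (rule finite_of_finite_coordinates)
qed

text \<open>A finite set is discrete in the Zariski topology, so both \<open>Y\<close> and its complement in \<open>Z\<close>
  are closed.\<close>

lemma finite_irreducible_minimal:
  fixes Y Z :: "('k::field ^ 'n) set"
  assumes irr: "irreducible_space (subtopology zariski Z)" and fin: "finite Z"
    and Y: "Y \<subset> Z"
  shows "Y = {}"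
proof (rule ccontr)
  assume "Y \<noteq> {}"
  have closed: "closedin (subtopology zariski Z) S" if "S \<subseteq> Z" for S
    using closedin_zariski_finite[OF finite_subset[OF that fin]] that
    by (rule closedin_subset_topspace)
  have "Y \<union> (Z - Y) = topspace (subtopology zariski Z)"
    using Y by auto
  then have "Y = Z \<or> Z - Y = Z"
    using irr closed[of Y] closed[of "Z - Y"] Y unfolding irreducible_space_def by auto
  then show False
    using Y \<open>Y \<noteq> {}\<close> by blast
qed

lemma zariski_dim_le_1_if_integral_over_parameter:
  fixes V :: "('k::field ^ 'n) set"
  assumes \<tau>: "polyfun \<tau>" and int: "\<And>i. integral_over V \<tau> (\<lambda>z. z $ i)"
  shows "zariski_dim V \<le> 1"
  unfolding zariski_dim_def krull_dim_def
proof (rule Sup_least)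
  let ?X = "subtopology zariski V"
  fix r assume "r \<in> {ereal (real n) | n. \<exists>Z.
     (\<forall>i\<le>n. closedin ?X (Z i) \<and> irreducible_space (subtopology ?X (Z i))) \<and>
     (\<forall>i<n. Z i \<subset> Z (Suc i))}"
  then obtain n Z where r: "r = ereal (real n)"
    and Z: "\<And>i. i \<le> n \<Longrightarrow> closedin ?X (Z i)"
      "\<And>i. i \<le> n \<Longrightarrow> irreducible_space (subtopology ?X (Z i))"
    and chain: "\<And>i. i < n \<Longrightarrow> Z i \<subset> Z (Suc i)"
    by blast
  have sub: "Z i \<subseteq> V" if "i \<le> n" for i
    using closedin_subset[OF Z(1)[OF that]] by simp
  have irr: "irreducible_space (subtopology zariski (Z i))" if "i \<le> n" for i
    using Z(2)[OF that] sub[OF that] by (simp add: subtopology_subtopology Int_absorb1)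
  have "n < 2"
  proof (rule ccontr)
    assume "\<not> n < 2"
    then have n: "2 \<le> n" by simp
    have c: "Z 0 \<subset> Z 1" "Z 1 \<subset> Z 2"
      using chain[of 0] chain[of 1] n by (auto simp: numeral_2_eq_2)
    have "finite (Z 1)"
      using finite_proper_closed_subset[OF \<tau> int Z(1) sub irr c(2)] n by simp
    then have "Z 0 = {}"
      using finite_irreducible_minimal[OF irr _ c(1)] n by simp
    then show False
      using irr[of 0] by (simp add: irreducible_space_def)
  qed
  then have "real n \<le> 1"
    by simp
  then show "r \<le> 1"
    unfolding r one_ereal_def by simp
qed

section \<open>The fibres of the augmented map\<close>

lemma poly_cpoly_0: "poly (cpoly p) 0 = of_int (poly p 0)"
  by (simp add: poly_0_coeff_0 coeff_map_poly)

lemma degree_cpoly: "degree (cpoly p) = degree p"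
  by (rule degree_map_poly) simp

text \<open>As \<open>D\<close> vanishes at 0, it could only be constant by being zero. Clearing the denominator of
  the ratio of leading coefficients would turn this into an integral linear relation
  between \<open>\<phi>1\<close> and \<open>\<phi>2\<close>.\<close>

lemma degree_D_poly_pos:
  assumes "lead_coeff \<phi>1 \<noteq> 0" and "poly \<phi>1 0 = 0" and "poly \<phi>2 0 = 0"
    and lin_indep: "\<forall>m n :: int. smult m \<phi>1 + smult n \<phi>2 = 0 \<longrightarrow> m = 0 \<and> n = 0"
  shows "degree (D_poly \<phi>1 \<phi>2) > 0"
proof (rule ccontr)
  assume "\<not> degree (D_poly \<phi>1 \<phi>2) > 0"
  then obtain c where c: "D_poly \<phi>1 \<phi>2 = [:c:]"
    by (auto elim: degree_eq_zeroE)
  have "poly (D_poly \<phi>1 \<phi>2) 0 = 0"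
    using assms(2,3) by (simp add: D_poly_def poly_cpoly_0)
  then have D0: "D_poly \<phi>1 \<phi>2 = 0"
    using c by simp
  let ?a = "lead_coeff \<phi>1" and ?b = "lead_coeff \<phi>2"
  have "smult (- ?b) \<phi>1 + smult ?a \<phi>2 = 0"
  proof (rule poly_eqI)
    fix i
    have "coeff (D_poly \<phi>1 \<phi>2) i = 0"
      using D0 by simp
    then have "(of_int (?a * coeff \<phi>2 i) :: complex) = of_int (?b * coeff \<phi>1 i)"
      using assms(1) by (simp add: D_poly_def lead_ratio_def coeff_map_poly field_simps)
    then have "?a * coeff \<phi>2 i = ?b * coeff \<phi>1 i"
      by (simp only: of_int_eq_iff)
    then show "coeff (smult (- ?b) \<phi>1 + smult ?a \<phi>2) i = coeff 0 i"
      by simp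
  qed
  then show False
    using lin_indep assms(1) by blast
qed

text \<open>The order of elimination is \<open>y\<^sub>2\<close>, then \<open>y\<^sub>4\<close> through \<open>D\<close>, then \<open>y\<^sub>1\<close> and \<open>y\<^sub>3\<close> through
  \<open>\<phi>2\<close>: each equation expresses a nonconstant polynomial in the new coordinate by a
  coordinate already known to be integral.\<close>

lemma integral_over_coordinates_aug_fibre:
  assumes D: "degree (D_poly \<phi>1 \<phi>2) > 0" and \<phi>2: "degree \<phi>2 > 0"
  shows "integral_over (aug_fibre \<phi>1 \<phi>2 (vector [c, u, v])) (\<lambda>y. y $ 2) (\<lambda>y. y $ i)"
proof -
  let ?V = "aug_fibre \<phi>1 \<phi>2 (vector [c, u, v])" and ?\<tau> = "\<lambda>y :: complex ^ 4. y $ 2"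
  let ?D = "D_poly \<phi>1 \<phi>2" and ?f = "cpoly \<phi>2"
  have eqs: "poly ?D (y $ 4) = poly ?D (y $ 2) + c"
    "poly ?f (y $ 1) = poly ?f (y $ 2) + u"
    "poly ?f (y $ 3) = poly ?f (y $ 4) + - v" if "y \<in> ?V" for y
    using that by (auto simp: aug_fibre_def aug_map_def Finite_Cartesian_Product.vec_eq_iff forall_3 algebra_simps)
  have \<phi>2': "degree ?f > 0"
    using \<phi>2 by (simp add: degree_cpoly)
  have y2: "integral_over ?V ?\<tau> (\<lambda>y. y $ 2)"
    using integral_over_parameter[of ?V ?\<tau> "[:0, 1:]"] by simp
  have "integral_over ?V ?\<tau> (\<lambda>y. poly ?D (y $ 2) + c)"
    by (intro integral_over_add_mult integral_over_poly y2 integral_over_const)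
  then have "integral_over ?V ?\<tau> (\<lambda>y. poly ?D (y $ 4))"
    by (rule integral_over_cong[rotated]) (simp add: eqs)
  then have y4: "integral_over ?V ?\<tau> (\<lambda>y. y $ 4)"
    by (rule integral_over_of_poly[OF D])
  have "integral_over ?V ?\<tau> (\<lambda>y. poly ?f (y $ 2) + u)"
    by (intro integral_over_add_mult integral_over_poly y2 integral_over_const)
  then have "integral_over ?V ?\<tau> (\<lambda>y. poly ?f (y $ 1))"
    by (rule integral_over_cong[rotated]) (simp add: eqs)
  then have y1: "integral_over ?V ?\<tau> (\<lambda>y. y $ 1)"
    by (rule integral_over_of_poly[OF \<phi>2'])
  have "integral_over ?V ?\<tau> (\<lambda>y. poly ?f (y $ 4) + - v)"
    by (intro integral_over_add_mult integral_over_poly y4 integral_over_const)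
  then have "integral_over ?V ?\<tau> (\<lambda>y. poly ?f (y $ 3))"
    by (rule integral_over_cong[rotated]) (simp add: eqs)
  then have y3: "integral_over ?V ?\<tau> (\<lambda>y. y $ 3)"
    by (rule integral_over_of_poly[OF \<phi>2'])
  show ?thesis
    using exhaust_4[of i] y1 y2 y3 y4 by auto
qed

theorem lemma6p3:
  fixes d :: nat and \<phi>1 \<phi>2 :: "int poly"
  assumes "d > 2"
    and "degree \<phi>1 = d" and "degree \<phi>2 = d"
    and "poly \<phi>1 0 = 0" and "poly \<phi>2 0 = 0"
    and lin_indep: "\<forall>m n :: int. smult m \<phi>1 + smult n \<phi>2 = 0 \<longrightarrow> m = 0 \<and> n = 0"
  shows "\<forall>c u v :: complex. zariski_dim (aug_fibre \<phi>1 \<phi>2 (vector [c, u, v])) \<le> 1"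
proof (intro allI)
  fix c u v :: complex
  have "lead_coeff \<phi>1 \<noteq> 0"
    using assms(1,2) by auto
  then have "degree (D_poly \<phi>1 \<phi>2) > 0"
    by (rule degree_D_poly_pos) (use assms in auto)
  then show "zariski_dim (aug_fibre \<phi>1 \<phi>2 (vector [c, u, v])) \<le> 1"
    using assms(1,3)
    by (intro zariski_dim_le_1_if_integral_over_parameter[of "\<lambda>y. y $ 2"]
        integral_over_coordinates_aug_fibre polyfun_coord) auto
qed

end
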